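(* Let $n\ge 1$ and $\alpha\in[0,1)$. The range-restricted geometric mechanism $\mathrm{GM}$ of size $n$ with parameter $\alpha$ is the unique minimizer of $\mathbb{L}_0$ among all $\alpha$-differentially private mechanisms of size $n$.
   Context: Write $[n]=\{0,1,\dots,n\}$. A mechanism of size $n$ is an $(n+1)\times(n+1)$ column-stochastic real matrix $\mathcal P$ with rows (outputs) and columns (inputs) indexed by $[n]$; its entry in row $i$, column $j$ is written $\Pr[i|j]$, so $\Pr[i|j]\ge 0$ and $\sum_{i}\Pr[i|j]=1$ for each $j$. It is $\alpha$-differentially private if $\Pr[i|j]\ge\alpha\Pr[i|j+1]$ and $\Pr[i|j+1]\ge\alpha\Pr[i|j]$ for all $i\in[n]$, $0\le j\le n-1$. $\mathbb{L}_0(\mathcal P)=\frac{n+1}{n}-\frac{\operatorname{trace}(\mathcal P)}{n}$. $\mathrm{GM}$: on input $j\in[n]$ it outputs $\min(\max(0,j+X),n)$, where $X$ is an integer random variable with $\Pr[X=\delta]=\frac{1-\alpha}{1+\alpha}\alpha^{|\delta|}$ for $\delta\in\mathbb Z$ (with $0^0=1$). Equivalently, with $x=\frac1{1+\alpha}$ and $y=\frac{1-\alpha}{1+\alpha}$: $\Pr[0|j]=x\alpha^{j}$, $\Pr[n|j]=x\alpha^{n-j}$, and $\Pr[i|j]=y\alpha^{|i-j|}$ for $0<i<n$. *)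

theory Defs
  imports "HOL-Probability.Probability" "Jordan_Normal_Form.Matrix"
begin

text \<open>Entry \<open>(i, j)\<close> is the probability of output \<open>i\<close> on input \<open>j\<close>; both range over $0, \dots, n$.\<close>

definition mechanism :: "nat \<Rightarrow> real mat \<Rightarrow> bool" where
  "mechanism n P \<longleftrightarrow>
     P \<in> carrier_mat (n + 1) (n + 1) \<and>
     (\<forall>i\<le>n. \<forall>j\<le>n. P $$ (i, j) \<ge> 0) \<and>
     (\<forall>j\<le>n. (\<Sum>i\<le>n. P $$ (i, j)) = 1)"

definition differentially_private :: "nat \<Rightarrow> real \<Rightarrow> real mat \<Rightarrow> bool" where
  "differentially_private n \<alpha> P \<longleftrightarrow>
     (\<forall>i\<le>n. \<forall>j<n. P $$ (i, j) \<ge> \<alpha> * P $$ (i, j + 1) \<and>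
                     P $$ (i, j + 1) \<ge> \<alpha> * P $$ (i, j))"

definition mat_trace :: "real mat \<Rightarrow> real" where
  "mat_trace A = (\<Sum>i<dim_row A. A $$ (i, i))"

definition L0 :: "nat \<Rightarrow> real mat \<Rightarrow> real" where
  "L0 n P = (real n + 1) / real n - mat_trace P / real n"

definition two_sided_geometric :: "real \<Rightarrow> int pmf" where
  "two_sided_geometric \<alpha> =
     embed_pmf (\<lambda>d. (1 - \<alpha>) / (1 + \<alpha>) * \<alpha> ^ nat \<bar>d\<bar>)"

text \<open>The weights below do form a probability distribution, so the use of
  \<^const>\<open>embed_pmf\<close> above is meaningful for every $0 \le \alpha < 1$.\<close>

lemma pmf_two_sided_geometric:
  assumes "0 \<le> \<alpha>" "\<alpha> < 1"
  shows "pmf (two_sided_geometric \<alpha>) d = (1 - \<alpha>) / (1 + \<alpha>) * \<alpha> ^ nat \<bar>d\<bar>"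
proof -
  define c where "c = (1 - \<alpha>) / (1 + \<alpha>)"
  have c0: "c \<ge> 0" using assms by (simp add: c_def)
  let ?f = "\<lambda>d::int. ennreal (c * \<alpha> ^ nat \<bar>d\<bar>)"
  let ?A = "range int" and ?B = "range (\<lambda>k. - int k - 1)"
  have U: "(UNIV :: int set) = ?A \<union> ?B"
  proof -
    have "x \<in> ?A \<union> ?B" for x :: int
    proof (cases "x \<ge> 0")
      case True
      then have "x = int (nat x)" by simp
      then show ?thesis by blast
    next
      case False
      then have "x = - int (nat (- x - 1)) - 1" by simp
      then show ?thesis by blast
    qed
    then show ?thesis by blast
  qed
  have D: "?A \<inter> ?B = {}" by auto
  have s1: "(\<lambda>k. c * \<alpha> ^ k) sums (c * (1 / (1 - \<alpha>)))"
    using assms by (intro sums_mult geometric_sums) auto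
  have s2: "(\<lambda>k. c * \<alpha> ^ Suc k) sums (c * \<alpha> * (1 / (1 - \<alpha>)))"
    using sums_mult[OF geometric_sums[of \<alpha>], of "c * \<alpha>"] assms by (simp add: mult_ac)
  have A: "(\<integral>\<^sup>+ d. ?f d \<partial>count_space ?A) = ennreal (c * (1 / (1 - \<alpha>)))"
  proof -
    have "(\<integral>\<^sup>+ d. ?f d \<partial>count_space ?A) = (\<integral>\<^sup>+ k. ?f (int k) \<partial>count_space UNIV)"
      by (intro nn_integral_bij_count_space[symmetric]) (auto simp: bij_betw_def)
    also have "\<dots> = (\<Sum>k. ennreal (c * \<alpha> ^ k))"
      by (simp add: nn_integral_count_space_nat)
    also have "\<dots> = ennreal (c * (1 / (1 - \<alpha>)))"
      using c0 assms s1 by (intro suminf_ennreal_eq) auto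
    finally show ?thesis .
  qed
  have B: "(\<integral>\<^sup>+ d. ?f d \<partial>count_space ?B) = ennreal (c * \<alpha> * (1 / (1 - \<alpha>)))"
  proof -
    have "(\<integral>\<^sup>+ d. ?f d \<partial>count_space ?B) = (\<integral>\<^sup>+ k. ?f (- int k - 1) \<partial>count_space UNIV)"
      by (intro nn_integral_bij_count_space[symmetric]) (auto simp: bij_betw_def inj_on_def)
    also have "\<dots> = (\<Sum>k. ennreal (c * \<alpha> ^ Suc k))"
    proof -
      have "nat \<bar>- int k - 1\<bar> = Suc k" for k by linarith
      then show ?thesis by (simp add: nn_integral_count_space_nat)
    qed
    also have "\<dots> = ennreal (c * \<alpha> * (1 / (1 - \<alpha>)))"
      using c0 assms s2 by (intro suminf_ennreal_eq) auto
    finally show ?thesis .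
  qed
  have "(\<integral>\<^sup>+ d. ?f d \<partial>count_space UNIV) =
        (\<integral>\<^sup>+ d. ?f d \<partial>count_space ?A) + (\<integral>\<^sup>+ d. ?f d \<partial>count_space ?B)"
    using nn_integral_disjoint_pair_countspace[of ?A ?B ?f] D U
    by (simp add: nn_integral_count_space_indicator)
  also have "\<dots> = ennreal (c * (1 / (1 - \<alpha>)) + c * \<alpha> * (1 / (1 - \<alpha>)))"
    unfolding A B using c0 assms by (intro ennreal_plus[symmetric]) auto
  also have "c * (1 / (1 - \<alpha>)) + c * \<alpha> * (1 / (1 - \<alpha>)) = 1"
  proof -
    have "1 + \<alpha> \<noteq> 0" "1 - \<alpha> \<noteq> 0" using assms by auto
    moreover have "c * (1 / (1 - \<alpha>)) + c * \<alpha> * (1 / (1 - \<alpha>)) = c * (1 + \<alpha>) / (1 - \<alpha>)"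
      by (simp add: add_divide_distrib[symmetric] algebra_simps)
    ultimately show ?thesis by (simp add: c_def)
  qed
  finally have "(\<integral>\<^sup>+ d. ?f d \<partial>count_space UNIV) = 1" by simp
  then show ?thesis
    unfolding two_sided_geometric_def c_def[symmetric]
    using c0 assms by (intro pmf_embed_pmf) auto
qed

definition GM :: "nat \<Rightarrow> real \<Rightarrow> real mat" where
  "GM n \<alpha> = mat (n + 1) (n + 1) (\<lambda>(i, j).
     pmf (map_pmf (\<lambda>d. min (max 0 (int j + d)) (int n)) (two_sided_geometric \<alpha>)) (int i))"

end

theory Submission
  imports Defs
begin

text \<open>
  Let $K_{ij} = \alpha^{|i-j|}$ and let $w_i$ be the diagonal entries of the geometric mechanism,
  whose entries are $K_{ij} w_i$. Privacy forces $\Pr[i|j] \ge K_{ij} \Pr[i|i]$, so the diagonal $d$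
  of a private mechanism satisfies $K d \le 1$. As $K$ is symmetric and $K w = 1$, the vector $w$
  is also a dual certificate: $\sum_i d_i = \langle d, K w\rangle = \langle K d, w\rangle \le \sum_j w_j$.
  Since $w > 0$, equality forces every privacy inequality above to be tight and $K d = 1$,
  and this linear system has $w$ as its only solution.
\<close>

section \<open>Diagonal weights and the geometric kernel\<close>

definition weight :: "nat \<Rightarrow> real \<Rightarrow> nat \<Rightarrow> real" where
  "weight n \<alpha> i = (if i = 0 \<or> i = n then 1 / (1 + \<alpha>) else (1 - \<alpha>) / (1 + \<alpha>))"

definition kernel :: "real \<Rightarrow> nat \<Rightarrow> nat \<Rightarrow> real" where
  "kernel \<alpha> i j = \<alpha> ^ nat \<bar>int i - int j\<bar>"

lemma weight_pos: "0 \<le> \<alpha> \<Longrightarrow> \<alpha> < 1 \<Longrightarrow> weight n \<alpha> i > 0"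
  by (simp add: weight_def)

lemma kernel_nonneg: "0 \<le> \<alpha> \<Longrightarrow> kernel \<alpha> i j \<ge> 0"
  by (simp add: kernel_def)

lemma kernel_self [simp]: "kernel \<alpha> i i = 1"
  by (simp add: kernel_def)

lemma kernel_commute: "kernel \<alpha> i j = kernel \<alpha> j i"
  by (simp add: kernel_def abs_minus_commute)

lemma kernel_le: "i \<le> j \<Longrightarrow> kernel \<alpha> i j = \<alpha> ^ (j - i)"
  by (simp add: kernel_def nat_diff_distrib)

lemma kernel_ge: "j \<le> i \<Longrightarrow> kernel \<alpha> i j = \<alpha> ^ (i - j)"
  by (simp add: kernel_commute[of \<alpha> i] kernel_le)

text \<open>Moving \<open>j\<close> by one changes the exponent |i - j| by exactly one. In the
  direction where the exponent grows by one, the bound is an equality; in the other it loses the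
  factor \<alpha>^2 \<le> 1.\<close>

lemma kernel_Suc:
  assumes "0 \<le> \<alpha>" "\<alpha> \<le> 1"
  shows "\<alpha> * kernel \<alpha> i (Suc j) \<le> kernel \<alpha> i j" "\<alpha> * kernel \<alpha> i j \<le> kernel \<alpha> i (Suc j)"
proof -
  have *: "\<alpha> * (\<alpha> * \<alpha> ^ k) \<le> \<alpha> ^ k" for k
    using power_decreasing[of k "Suc (Suc k)" \<alpha>] assms by simp
  show "\<alpha> * kernel \<alpha> i (Suc j) \<le> kernel \<alpha> i j"
  proof (cases "i \<le> j")
    case True
    then show ?thesis using *[of "j - i"] by (simp add: kernel_le Suc_diff_le)
  next
    case False
    then have "i - j = Suc (i - Suc j)" by simp
    with False show ?thesis by (simp add: kernel_ge)
  qed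
  show "\<alpha> * kernel \<alpha> i j \<le> kernel \<alpha> i (Suc j)"
  proof (cases "i \<le> j")
    case True
    then show ?thesis by (simp add: kernel_le Suc_diff_le)
  next
    case False
    then have "i - j = Suc (i - Suc j)" by simp
    with False show ?thesis using *[of "i - Suc j"] by (simp add: kernel_ge)
  qed
qed

text \<open>Subtracting \<alpha> times equation \<open>j\<close> from equation \<open>Suc j\<close>
  eliminates all unknowns up to \<open>j\<close> and fixes the tail sum \<open>R (Suc j)\<close>.
  Two consecutive tails then determine each unknown.\<close>

lemma kernel_solution_unique:
  assumes "n \<ge> 1" "0 \<le> \<alpha>" "\<alpha> < 1"
    and sol: "\<And>j. j \<le> n \<Longrightarrow> (\<Sum>i\<le>n. kernel \<alpha> i j * d i) = 1"
    and "k \<le> n"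
  shows "d k = weight n \<alpha> k"
proof -
  \<comment> \<open>The part of equation \<open>j\<close> on and beyond the diagonal.\<close>
  define R where "R j = (\<Sum>i\<in>{j..n}. \<alpha> ^ (i - j) * d i)" for j
  have R_rec: "R j = d j + \<alpha> * R (Suc j)" if "j \<le> n" for j
  proof -
    have "R j = d j + (\<Sum>i\<in>{Suc j..n}. \<alpha> ^ (i - j) * d i)"
      using that by (simp add: R_def sum.atLeast_Suc_atMost)
    also have "(\<Sum>i\<in>{Suc j..n}. \<alpha> ^ (i - j) * d i) = \<alpha> * R (Suc j)"
      unfolding R_def sum_distrib_left
    proof (intro sum.cong refl)
      fix i assume "i \<in> {Suc j..n}"
      then have "i - j = Suc (i - Suc j)" by auto
      then show "\<alpha> ^ (i - j) * d i = \<alpha> * (\<alpha> ^ (i - Suc j) * d i)" by simp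
    qed
    finally show ?thesis .
  qed
  have R_Suc: "R (Suc j) = 1 / (1 + \<alpha>)" if "Suc j \<le> n" for j
  proof -
    have "1 - \<alpha> = (\<Sum>i\<le>n. kernel \<alpha> i (Suc j) * d i) - \<alpha> * (\<Sum>i\<le>n. kernel \<alpha> i j * d i)"
      using sol[OF that] sol[of j] that by simp
    also have "\<dots> = (\<Sum>i\<le>n. (kernel \<alpha> i (Suc j) - \<alpha> * kernel \<alpha> i j) * d i)"
      by (simp add: sum_distrib_left sum_subtractf[symmetric] algebra_simps)
    also have "\<dots> = (\<Sum>i\<in>{Suc j..n}. (kernel \<alpha> i (Suc j) - \<alpha> * kernel \<alpha> i j) * d i)"
      \<comment> \<open>For \<open>i \<le> j\<close>, stepping from \<open>j\<close> to
        \<open>Suc j\<close> multiplies the kernel by \<alpha>, so these terms cancel.\<close>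
      by (intro sum.mono_neutral_right) (auto simp: kernel_le Suc_diff_le not_less_eq_eq)
    also have "\<dots> = (1 - \<alpha>\<^sup>2) * R (Suc j)"
      unfolding R_def sum_distrib_left
    proof (intro sum.cong refl)
      fix i assume "i \<in> {Suc j..n}"
      then have "i - j = Suc (i - Suc j)" "Suc j \<le> i" by auto
      then show "(kernel \<alpha> i (Suc j) - \<alpha> * kernel \<alpha> i j) * d i = (1 - \<alpha>\<^sup>2) * (\<alpha> ^ (i - Suc j) * d i)"
        by (simp add: kernel_ge power2_eq_square algebra_simps)
    qed
    \<comment> \<open>Factor 1 - \<alpha>^2 = (1 - \<alpha>)(1 + \<alpha>); the first factor is
      nonzero because \<alpha> < 1.\<close>
    finally have "(1 - \<alpha>) * ((1 + \<alpha>) * R (Suc j)) = (1 - \<alpha>) * 1"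
      by (simp add: power2_eq_square algebra_simps)
    then have "(1 + \<alpha>) * R (Suc j) = 1"
      using assms(3) by (subst (asm) mult_left_cancel) auto
    then show ?thesis using assms(2) by (simp add: field_simps)
  qed
  have R_0: "R 0 = 1"
    using sol[of 0] by (simp add: R_def kernel_ge atMost_atLeast0)
  have R_end: "R (Suc n) = 0"
    by (simp add: R_def)
  have "d k = R k - \<alpha> * R (Suc k)"
    using R_rec[OF \<open>k \<le> n\<close>] by simp
  moreover have "R k = (if k = 0 then 1 else 1 / (1 + \<alpha>))"
    using R_0 R_Suc[of "k - 1"] \<open>k \<le> n\<close> by auto
  moreover have "R (Suc k) = (if k = n then 0 else 1 / (1 + \<alpha>))"
    using R_end R_Suc[of k] \<open>k \<le> n\<close> by auto
  ultimately show ?thesis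
    using assms(1,2) by (auto simp: weight_def field_simps)
qed

section \<open>Consequences of privacy along a row\<close>

lemma differentially_private_power:
  assumes dp: "differentially_private n \<alpha> P" and "0 \<le> \<alpha>" and "i \<le> n" and "j + k \<le> n"
  shows "\<alpha> ^ k * P $$ (i, j) \<le> P $$ (i, j + k) \<and> \<alpha> ^ k * P $$ (i, j + k) \<le> P $$ (i, j)"
  using \<open>j + k \<le> n\<close>
proof (induction k)
  case (Suc k)
  have up: "\<alpha> * P $$ (i, j + k) \<le> P $$ (i, j + Suc k)"
    and down: "\<alpha> * P $$ (i, j + Suc k) \<le> P $$ (i, j + k)"
    using dp \<open>i \<le> n\<close> Suc.prems by (auto simp: differentially_private_def)
  have "\<alpha> * (\<alpha> ^ k * P $$ (i, j)) \<le> \<alpha> * P $$ (i, j + k)"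
    using Suc \<open>0 \<le> \<alpha>\<close> by (intro mult_left_mono) auto
  moreover have "\<alpha> ^ k * (\<alpha> * P $$ (i, j + Suc k)) \<le> \<alpha> ^ k * P $$ (i, j + k)"
    using down \<open>0 \<le> \<alpha>\<close> by (intro mult_left_mono) auto
  ultimately show ?case
    using up Suc by (auto simp: mult_ac)
qed simp

text \<open>Chain the neighbouring constraints from the diagonal outwards, in either direction.
  Summed over \<open>i\<close>, the bounds constrain the diagonal alone.\<close>

lemma differentially_private_diag:
  assumes "differentially_private n \<alpha> P" "0 \<le> \<alpha>" "i \<le> n" "j \<le> n"
  shows "kernel \<alpha> i j * P $$ (i, i) \<le> P $$ (i, j)"
proof (cases "i \<le> j")
  case True
  then show ?thesis
    using differentially_private_power[OF assms(1-3), of i "j - i"] assms(4)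
    by (simp add: kernel_le)
next
  case False
  then show ?thesis
    using differentially_private_power[OF assms(1-3), of j "i - j"] assms(3)
    by (simp add: kernel_ge)
qed

section \<open>The geometric mechanism in closed form\<close>

text \<open>The sign \<open>s\<close> treats both tails at once: clamping at 0 collects the lower
  tail of the noise, clamping at \<open>n\<close> the upper one.\<close>

lemma geometric_tail:
  fixes s :: int
  assumes "0 \<le> \<alpha>" "\<alpha> < 1" and s: "s = 1 \<or> s = -1"
  shows "measure_pmf.prob (two_sided_geometric \<alpha>) {d. s * d \<ge> int j} = \<alpha> ^ j / (1 + \<alpha>)"
proof -
  let ?A = "\<lambda>k. {s * (int j + int k)}"
  \<comment> \<open>Since s * s = 1, the points of the tail are s * (j + k) for natural
    \<open>k\<close>.\<close>
  have U: "{d. s * d \<ge> int j} = (\<Union>k. ?A k)"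
  proof (intro Set.set_eqI iffI)
    fix d assume "d \<in> {d. s * d \<ge> int j}"
    then have "d \<in> ?A (nat (s * d - int j))" using s by auto
    then show "d \<in> (\<Union>k. ?A k)" by blast
  qed (use s in auto)
  have "(\<lambda>k. measure_pmf.prob (two_sided_geometric \<alpha>) (?A k)) sums
      measure_pmf.prob (two_sided_geometric \<alpha>) (\<Union>k. ?A k)"
    by (rule measure_pmf.finite_measure_UNION) (use s in \<open>auto simp: disjoint_family_on_def\<close>)
  moreover have "measure_pmf.prob (two_sided_geometric \<alpha>) (?A k) =
      (1 - \<alpha>) / (1 + \<alpha>) * \<alpha> ^ j * \<alpha> ^ k" for k
  proof -
    have "nat \<bar>s * (int j + int k)\<bar> = j + k" using s by auto
    then show ?thesis
      by (simp add: measure_pmf_single pmf_two_sided_geometric[OF assms(1,2)] power_add)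
  qed
  moreover have "(\<lambda>k. (1 - \<alpha>) / (1 + \<alpha>) * \<alpha> ^ j * \<alpha> ^ k) sums
      ((1 - \<alpha>) / (1 + \<alpha>) * \<alpha> ^ j * (1 / (1 - \<alpha>)))"
    using assms(1,2) by (intro sums_mult geometric_sums) auto
  ultimately have "measure_pmf.prob (two_sided_geometric \<alpha>) (\<Union>k. ?A k) =
      (1 - \<alpha>) / (1 + \<alpha>) * \<alpha> ^ j * (1 / (1 - \<alpha>))"
    by (simp add: sums_unique2)
  also have "\<dots> = \<alpha> ^ j / (1 + \<alpha>)"
    using assms(2) by simp
  finally show ?thesis by (simp add: U)
qed

text \<open>An extreme output absorbs a whole tail of the noise, an interior output a single noise
  value; hence the two cases of \<open>weight\<close>.\<close>

lemma GM_index: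
  assumes "n \<ge> 1" "0 \<le> \<alpha>" "\<alpha> < 1" "i \<le> n" "j \<le> n"
  shows "GM n \<alpha> $$ (i, j) = kernel \<alpha> i j * weight n \<alpha> i"
proof -
  let ?c = "\<lambda>d. min (max 0 (int j + d)) (int n)"
  have GM: "GM n \<alpha> $$ (i, j) = measure_pmf.prob (two_sided_geometric \<alpha>) (?c -` {int i})"
    using assms by (simp add: GM_def pmf_map)
  consider "i = 0" | "i = n" "i \<noteq> 0" | "0 < i" "i < n"
    using assms(4) by linarith
  then show ?thesis
  proof cases
    case 1
    then have "?c -` {int i} = {d. (-1) * d \<ge> int j}" using assms(1) by auto
    then have "GM n \<alpha> $$ (i, j) = \<alpha> ^ j / (1 + \<alpha>)"
      using GM geometric_tail[OF assms(2,3), of "-1" j] by simp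
    with 1 show ?thesis by (simp add: weight_def kernel_le)
  next
    case 2
    then have "?c -` {int i} = {d. 1 * d \<ge> int (n - j)}" using assms(5) by auto
    then have "GM n \<alpha> $$ (i, j) = \<alpha> ^ (n - j) / (1 + \<alpha>)"
      using GM geometric_tail[OF assms(2,3), of 1 "n - j"] by simp
    with 2 show ?thesis using assms(5) by (simp add: weight_def kernel_ge)
  next
    case 3
    then have "?c -` {int i} = {int i - int j}" by auto
    then have "GM n \<alpha> $$ (i, j) = (1 - \<alpha>) / (1 + \<alpha>) * \<alpha> ^ nat \<bar>int i - int j\<bar>"
      using GM by (simp add: measure_pmf_single pmf_two_sided_geometric[OF assms(2,3)])
    with 3 show ?thesis by (simp add: weight_def kernel_def)
  qed
qed

text \<open>Each column is the law of a variable clamped to 0, ..., n, so its entries add up to the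
  total mass.\<close>

lemma mechanism_GM: "mechanism n (GM n \<alpha>)"
proof -
  have "(\<Sum>i\<le>n. GM n \<alpha> $$ (i, j)) = 1" if "j \<le> n" for j
  proof -
    let ?p = "map_pmf (\<lambda>d. min (max 0 (int j + d)) (int n)) (two_sided_geometric \<alpha>)"
    have "(\<Sum>i\<le>n. GM n \<alpha> $$ (i, j)) = (\<Sum>i\<le>n. pmf ?p (int i))"
      using that by (intro sum.cong refl) (simp add: GM_def)
    also have "\<dots> = (\<Sum>i\<in>int ` {..n}. pmf ?p i)"
      by (simp add: sum.reindex)
    also have "\<dots> = 1"
    proof (rule sum_pmf_eq_1)
      have "x \<in> int ` {..n}" if "0 \<le> x" "x \<le> int n" for x
        using that by (intro image_eqI[of _ _ "nat x"]) auto
      then show "set_pmf ?p \<subseteq> int ` {..n}" by auto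
    qed simp
    finally show ?thesis .
  qed
  then show ?thesis by (auto simp: mechanism_def GM_def)
qed

lemma differentially_private_GM:
  assumes "n \<ge> 1" "0 \<le> \<alpha>" "\<alpha> < 1"
  shows "differentially_private n \<alpha> (GM n \<alpha>)"
proof -
  have "\<alpha> * (kernel \<alpha> i (Suc j) * weight n \<alpha> i) \<le> kernel \<alpha> i j * weight n \<alpha> i"
    "\<alpha> * (kernel \<alpha> i j * weight n \<alpha> i) \<le> kernel \<alpha> i (Suc j) * weight n \<alpha> i" for i j
    using kernel_Suc[of \<alpha> i j] weight_pos[of \<alpha> n i] assms
    by (simp_all add: mult.assoc[symmetric] mult_right_mono)
  then show ?thesis
    using assms by (simp add: differentially_private_def GM_index)
qed

text \<open>The identity K w = 1 is read off from the column sums of \<open>GM\<close>, without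
  summing any finite geometric series.\<close>

lemma kernel_weight_sum:
  assumes "n \<ge> 1" "0 \<le> \<alpha>" "\<alpha> < 1" "j \<le> n"
  shows "(\<Sum>i\<le>n. kernel \<alpha> i j * weight n \<alpha> i) = 1"
proof -
  have "(\<Sum>i\<le>n. kernel \<alpha> i j * weight n \<alpha> i) = (\<Sum>i\<le>n. GM n \<alpha> $$ (i, j))"
    using assms by (intro sum.cong refl) (simp add: GM_index)
  also have "\<dots> = 1"
    using mechanism_GM assms(4) by (simp add: mechanism_def)
  finally show ?thesis .
qed

section \<open>Maximality of the trace and the equality case\<close>

lemma mat_trace_mechanism: "mechanism n P \<Longrightarrow> mat_trace P = (\<Sum>i\<le>n. P $$ (i, i))"
  by (auto simp: mat_trace_def mechanism_def lessThan_Suc_atMost)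

lemma mat_trace_GM:
  assumes "n \<ge> 1" "0 \<le> \<alpha>" "\<alpha> < 1"
  shows "mat_trace (GM n \<alpha>) = (\<Sum>i\<le>n. weight n \<alpha> i)"
  using assms by (simp add: mat_trace_mechanism[OF mechanism_GM] GM_index)

text \<open>The duality gap written exactly as the privacy slacks weighted by the dual
  certificate.\<close>

lemma mat_trace_deficit:
  assumes "n \<ge> 1" "0 \<le> \<alpha>" "\<alpha> < 1" and P: "mechanism n P"
  shows "mat_trace (GM n \<alpha>) - mat_trace P =
    (\<Sum>j\<le>n. \<Sum>i\<le>n. weight n \<alpha> j * (P $$ (i, j) - kernel \<alpha> i j * P $$ (i, i)))"
proof -
  have "(\<Sum>j\<le>n. \<Sum>i\<le>n. weight n \<alpha> j * (kernel \<alpha> i j * P $$ (i, i)))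
      = (\<Sum>i\<le>n. \<Sum>j\<le>n. weight n \<alpha> j * (kernel \<alpha> i j * P $$ (i, i)))"
    by (rule sum.swap)
  \<comment> \<open>Symmetry of the kernel turns the inner sum into K w = 1.\<close>
  also have "\<dots> = (\<Sum>i\<le>n. P $$ (i, i) * (\<Sum>j\<le>n. kernel \<alpha> j i * weight n \<alpha> j))"
    unfolding sum_distrib_left
    by (intro sum.cong refl) (simp add: kernel_commute mult_ac)
  also have "\<dots> = mat_trace P"
    using assms by (simp add: mat_trace_mechanism kernel_weight_sum)
  finally have 1: "(\<Sum>j\<le>n. \<Sum>i\<le>n. weight n \<alpha> j * (kernel \<alpha> i j * P $$ (i, i))) = mat_trace P" .
  \<comment> \<open>Columns of \<open>P\<close> sum to 1, which leaves the sum of the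
    weights.\<close>
  have "(\<Sum>j\<le>n. \<Sum>i\<le>n. weight n \<alpha> j * P $$ (i, j)) = mat_trace (GM n \<alpha>)"
    using assms by (simp add: mat_trace_GM sum_distrib_left[symmetric] mechanism_def)
  with 1 show ?thesis
    by (simp add: right_diff_distrib sum_subtractf)
qed

lemma deficit_nonneg:
  assumes "0 \<le> \<alpha>" "\<alpha> < 1" "differentially_private n \<alpha> P" "i \<le> n" "j \<le> n"
  shows "0 \<le> weight n \<alpha> j * (P $$ (i, j) - kernel \<alpha> i j * P $$ (i, i))"
  using differentially_private_diag[of n \<alpha> P i j] weight_pos[of \<alpha> n j] assms by simp

lemma mat_trace_le_GM:
  assumes "n \<ge> 1" "0 \<le> \<alpha>" "\<alpha> < 1" "mechanism n P" "differentially_private n \<alpha> P"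
  shows "mat_trace P \<le> mat_trace (GM n \<alpha>)"
proof -
  have "0 \<le> (\<Sum>j\<le>n. \<Sum>i\<le>n. weight n \<alpha> j * (P $$ (i, j) - kernel \<alpha> i j * P $$ (i, i)))"
    using assms by (intro sum_nonneg deficit_nonneg) auto
  then show ?thesis
    using mat_trace_deficit[OF assms(1-4)] by simp
qed

text \<open>Complementary slackness: a zero gap makes each nonnegative summand vanish, so
  \<open>P\<close> is determined by its diagonal, which solves K d = 1.\<close>

lemma mat_trace_eq_GM:
  assumes "n \<ge> 1" "0 \<le> \<alpha>" "\<alpha> < 1" and P: "mechanism n P" and dp: "differentially_private n \<alpha> P"
    and eq: "mat_trace P = mat_trace (GM n \<alpha>)"
  shows "P = GM n \<alpha>"
proof -
  let ?t = "\<lambda>j i. weight n \<alpha> j * (P $$ (i, j) - kernel \<alpha> i j * P $$ (i, i))"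
  have nonneg: "0 \<le> ?t j i" if "i \<le> n" "j \<le> n" for i j
    using deficit_nonneg[OF assms(2,3) dp that] .
  have "(\<Sum>j\<le>n. \<Sum>i\<le>n. ?t j i) = 0"
    using mat_trace_deficit[OF assms(1-4)] eq by simp
  then have "(\<Sum>i\<le>n. ?t j i) = 0" if "j \<le> n" for j
    using that nonneg by (subst (asm) sum_nonneg_eq_0_iff) (auto intro: sum_nonneg)
  then have "?t j i = 0" if "i \<le> n" "j \<le> n" for i j
    using that nonneg sum_nonneg_eq_0_iff[of "{..n}" "?t j"] by auto
  \<comment> \<open>Strict positivity of the weight allows it to be cancelled.\<close>
  then have tight: "P $$ (i, j) = kernel \<alpha> i j * P $$ (i, i)" if "i \<le> n" "j \<le> n" for i j
    using that weight_pos[OF assms(2,3), of n j] by force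
  have "(\<Sum>i\<le>n. kernel \<alpha> i j * P $$ (i, i)) = 1" if "j \<le> n" for j
  proof -
    have "(\<Sum>i\<le>n. kernel \<alpha> i j * P $$ (i, i)) = (\<Sum>i\<le>n. P $$ (i, j))"
      using that by (intro sum.cong refl) (simp add: tight[of _ j])
    then show ?thesis using P that by (simp add: mechanism_def)
  qed
  then have "P $$ (i, i) = weight n \<alpha> i" if "i \<le> n" for i
    using kernel_solution_unique[OF assms(1-3), of "\<lambda>i. P $$ (i, i)"] that by simp
  with tight have entries: "P $$ (i, j) = GM n \<alpha> $$ (i, j)" if "i \<le> n" "j \<le> n" for i j
    using that assms(1-3) by (metis GM_index)
  have "P \<in> carrier_mat (n + 1) (n + 1)" "GM n \<alpha> \<in> carrier_mat (n + 1) (n + 1)"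
    using P mechanism_GM by (auto simp: mechanism_def)
  then show ?thesis
    by (intro eq_matI) (auto intro: entries)
qed

theorem theorem3:
  fixes n :: nat and \<alpha> :: real
  assumes "n \<ge> 1" and "0 \<le> \<alpha>" and "\<alpha> < 1"
  shows "\<forall>P. is_arg_min (L0 n) (\<lambda>Q. mechanism n Q \<and> differentially_private n \<alpha> Q) P
               \<longleftrightarrow> P = GM n \<alpha>"
proof -
  \<comment> \<open>As \<open>n > 0\<close>, \<open>L0\<close> is a strictly decreasing affine
    function of the trace, so minimizing it means maximizing the trace.\<close>
  have L0_less: "L0 n P < L0 n Q \<longleftrightarrow> mat_trace Q < mat_trace P" for P Q
    using assms(1) by (simp add: L0_def divide_less_cancel)
  show ?thesis
    \<comment> \<open>A minimizer cannot have smaller trace than the feasible \<open>GM\<close>, and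
      the bound excludes a larger one; the equality case then identifies it.\<close>
    unfolding is_arg_min_def L0_less
    using mechanism_GM[of n \<alpha>] differentially_private_GM[OF assms]
      mat_trace_le_GM[OF assms] mat_trace_eq_GM[OF assms]
    by (metis linorder_not_less order_antisym)
qed

end
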